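(* Let $A \in M_n(\mathbb{C})$. Then the CMP-inverse $A^{c,\dagger}$ is an EP matrix if and only if $$A^{\dagger,d}(A^{c,\dagger})^{\dagger} = (A^{c,\dagger})^{\dagger}A^{d,\dagger}.$$
   Context: $M^{\dagger}$ is the Moore-Penrose inverse and $M^{d}$ the Drazin inverse of a square matrix $M$. A square matrix $M$ is EP if $MM^{\dagger}=M^{\dagger}M$. The core part of $A$ is $A_c=AA^{d}A$; the CMP-inverse is $A^{c,\dagger}=A^{\dagger}A_cA^{\dagger}$; the DMP inverse is $A^{d,\dagger}=A^{d}AA^{\dagger}$; the MPD inverse is $A^{\dagger,d}=A^{\dagger}AA^{d}$. *)

theory Defs
  imports "HOL-Analysis.Analysis"
begin

definition conj_transpose :: "complex ^ 'm ^ 'n \<Rightarrow> complex ^ 'n ^ 'm" where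
  "conj_transpose A = (\<chi> i j. cnj (A $ j $ i))"

(* The class operations on vectors of vectors are componentwise, so A ^ k
   would be the entrywise power. *)
primrec mat_power :: "complex ^ 'n ^ 'n \<Rightarrow> nat \<Rightarrow> complex ^ 'n ^ 'n" where
  "mat_power A 0 = mat 1"
| "mat_power A (Suc k) = A ** mat_power A k"

definition is_mp_inverse :: "complex ^ 'n ^ 'n \<Rightarrow> complex ^ 'n ^ 'n \<Rightarrow> bool" where
  "is_mp_inverse A X \<longleftrightarrow>
     A ** X ** A = A \<and> X ** A ** X = X \<and>
     conj_transpose (A ** X) = A ** X \<and> conj_transpose (X ** A) = X ** A"

(* Existence and uniqueness hold for every complex square matrix, so the
   description is always proper; likewise for the Drazin inverse below. *)
definition mp_inverse :: "complex ^ 'n ^ 'n \<Rightarrow> complex ^ 'n ^ 'n" where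
  "mp_inverse A = (THE X. is_mp_inverse A X)"

(* Drazin's original form: the last equation is required for some k. The least
   such k is the index of A, and the equation then holds for every larger k. *)
definition is_drazin_inverse :: "complex ^ 'n ^ 'n \<Rightarrow> complex ^ 'n ^ 'n \<Rightarrow> bool" where
  "is_drazin_inverse A X \<longleftrightarrow>
     X ** A ** X = X \<and> A ** X = X ** A \<and>
     (\<exists>k. mat_power A (Suc k) ** X = mat_power A k)"

definition drazin_inverse :: "complex ^ 'n ^ 'n \<Rightarrow> complex ^ 'n ^ 'n" where
  "drazin_inverse A = (THE X. is_drazin_inverse A X)"

definition EP_matrix :: "complex ^ 'n ^ 'n \<Rightarrow> bool" where
  "EP_matrix M \<longleftrightarrow> M ** mp_inverse M = mp_inverse M ** M"

definition core_part :: "complex ^ 'n ^ 'n \<Rightarrow> complex ^ 'n ^ 'n" where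
  "core_part A = A ** drazin_inverse A ** A"

definition cmp_inverse :: "complex ^ 'n ^ 'n \<Rightarrow> complex ^ 'n ^ 'n" where
  "cmp_inverse A = mp_inverse A ** core_part A ** mp_inverse A"

definition dmp_inverse :: "complex ^ 'n ^ 'n \<Rightarrow> complex ^ 'n ^ 'n" where
  "dmp_inverse A = drazin_inverse A ** A ** mp_inverse A"

definition mpd_inverse :: "complex ^ 'n ^ 'n \<Rightarrow> complex ^ 'n ^ 'n" where
  "mpd_inverse A = mp_inverse A ** A ** drazin_inverse A"

end

theory Submission
  imports Defs
begin

text \<open>
  Write \<open>P\<close> for the Moore-Penrose inverse and \<open>D\<close> for the Drazin inverse of \<open>A\<close>, put \<open>H = P A\<close>
  and \<open>K = A P\<close>, let \<open>C = H D K\<close> be the CMP-inverse, \<open>Q\<close> its Moore-Penrose inverse, and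
  \<open>F = C Q\<close>, \<open>G = Q C\<close>. The MPD and DMP inverses are \<open>H D\<close> and \<open>D K\<close>. Since \<open>C\<close> and
  \<open>H D\<close> have the same range, contained in that of \<open>H\<close>, one gets \<open>F D = F H D = H D\<close>, and
  dually \<open>D G = D K\<close>. If \<open>H D Q = Q D K\<close>, then the right-hand side is fixed by \<open>F\<close> on the
  right and the left-hand side by \<open>G\<close> on the left; multiplying by \<open>C\<close> on the other side gives
  \<open>C = C F\<close> and \<open>C = G C\<close>, whence \<open>G = G F = F\<close>. Conversely, if \<open>F = G\<close>, then
  \<open>H D Q = F\<close> and \<open>Q D K = G\<close>.

  Both generalized inverses are obtained from an identity \<open>M\<^sup>k = M\<^sup>k\<^sup>+\<^sup>1 Y\<close> with \<open>Y\<close> commuting with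
  \<open>M\<close>, taken at \<open>M = A\<close> and at \<open>M = A\<^sup>* A\<close>.
\<close>

subsection \<open>Conjugate transposes and powers\<close>

lemma conj_transpose_mult:
  "conj_transpose (A ** B) = conj_transpose B ** conj_transpose A"
  by (simp add: conj_transpose_def matrix_matrix_mult_def vec_eq_iff mult.commute)

lemma conj_transpose_conj_transpose [simp]: "conj_transpose (conj_transpose A) = A"
  by (simp add: conj_transpose_def vec_eq_iff)

text \<open>The diagonal entries of \<open>M* M\<close> are the sums of squared moduli over the
  columns of \<open>M\<close>.\<close>

lemma conj_transpose_mult_self_eq_0:
  assumes "conj_transpose M ** M = 0"
  shows "M = 0"
proof -
  have "M $ k $ i = 0" for k i
  proof -
    have "(\<Sum>l\<in>UNIV. cnj (M $ l $ i) * M $ l $ i) = 0"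
      using assms by (simp add: conj_transpose_def matrix_matrix_mult_def vec_eq_iff)
    then have "complex_of_real (\<Sum>l\<in>UNIV. (cmod (M $ l $ i))\<^sup>2) = 0"
      by (simp add: complex_norm_square mult.commute del: of_real_power)
    then have "(\<Sum>l\<in>UNIV. (cmod (M $ l $ i))\<^sup>2) = 0"
      by (simp only: of_real_eq_0_iff)
    then show ?thesis
      by (simp add: sum_nonneg_eq_0_iff)
  qed
  then show ?thesis
    by (simp add: vec_eq_iff)
qed

lemma matrix_add_rdistrib: "(A + B) ** C = A ** C + B ** (C :: complex ^ 'n ^ 'm)"
  by (simp add: matrix_matrix_mult_def vec_eq_iff distrib_right sum.distrib)

lemma matrix_diff_ldistrib: "A ** (B - C) = A ** B - A ** (C :: complex ^ 'n ^ 'm)"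
  by (simp add: matrix_matrix_mult_def vec_eq_iff right_diff_distrib sum_subtractf)

lemma matrix_scaleR_left: "(r *\<^sub>R A) ** B = r *\<^sub>R (A ** (B :: complex ^ 'n ^ 'n))"
  by (simp add: matrix_matrix_mult_def vec_eq_iff scaleR_sum_right)

lemma matrix_scaleR_right: "A ** (r *\<^sub>R B) = r *\<^sub>R (A ** (B :: complex ^ 'n ^ 'n))"
  by (simp add: matrix_matrix_mult_def vec_eq_iff scaleR_sum_right)

lemma mat_power_add: "mat_power A (i + j) = mat_power A i ** mat_power A j"
  by (induction i) (simp_all add: matrix_mul_assoc)

lemma mat_power_commute:
  assumes "A ** B = B ** A"
  shows "mat_power A k ** B = B ** mat_power A k"
  by (induction k) (use assms in \<open>simp_all, metis matrix_mul_assoc\<close>)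

lemma mat_power_mult_left:
  assumes "A ** B = B ** A"
  shows "mat_power (A ** B) k = mat_power A k ** mat_power B k"
proof (induction k)
  case (Suc k)
  then show ?case
    using mat_power_commute[OF assms, of k] by simp (metis matrix_mul_assoc)
qed simp

lemma mat_power_Suc_right: "mat_power A (Suc k) = mat_power A k ** A"
  using mat_power_commute[of A A k] by simp

lemma mat_power_idempotent:
  assumes "e ** e = e"
  shows "mat_power e (Suc k) = e"
  using assms by (induction k) simp_all

text \<open>The spans of the tails \<open>A\<^sup>k, A\<^sup>k\<^sup>+\<^sup>1, \<dots>\<close> decrease, so they become stationary.\<close>

lemma mat_power_factorization:
  fixes A :: "complex ^ 'n ^ 'n"
  obtains k Y where "A ** Y = Y ** A" "mat_power A (Suc k) ** Y = mat_power A k"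
proof -
  define S where "S k = span (range (\<lambda>i. mat_power A (k + i)))" for k
  obtain k where k: "\<And>j. dim (S k) \<le> dim (S j)"
    using ex_has_least_nat[of "\<lambda>_. True" undefined "\<lambda>j. dim (S j)"] by auto
  have "mat_power A (Suc k + i) \<in> range (\<lambda>i. mat_power A (k + i))" for i
    by (rule range_eqI[of _ _ "Suc i"]) simp
  then have "S (Suc k) \<subseteq> S k"
    unfolding S_def by (intro span_mono) blast
  then have "S (Suc k) = S k"
    using k[of "Suc k"] by (intro subspace_dim_equal) (simp_all add: S_def)
  moreover have "mat_power A k \<in> S k"
    unfolding S_def by (intro span_base range_eqI[of _ _ 0]) simp
  ultimately have "mat_power A k \<in> S (Suc k)"
    by simp
  \<comment> \<open>Every \<open>Y\<close> built here is a polynomial in \<open>A\<close>, which is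
    why it commutes with \<open>A\<close>.\<close>
  moreover have "\<exists>Y. A ** Y = Y ** A \<and> mat_power A (Suc k) ** Y = M" if "M \<in> S (Suc k)" for M
    using that unfolding S_def
  proof (induction rule: span_induct_alt)
    case base
    show ?case
      by (intro exI[of _ 0]) (simp add: matrix_matrix_mult_def vec_eq_iff)
  next
    case (step c x y)
    then obtain i Y where i: "x = mat_power A (Suc k) ** mat_power A i"
      and Y: "A ** Y = Y ** A" "mat_power A (Suc k) ** Y = y"
      by (metis imageE mat_power_add)
    have "A ** mat_power A i = mat_power A i ** A"
      by (simp add: mat_power_commute)
    then show ?case
      by (intro exI[of _ "c *\<^sub>R mat_power A i + Y"])
        (simp only: i Y matrix_add_ldistrib matrix_add_rdistrib matrix_scaleR_left
          matrix_scaleR_right simp_thms)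
  qed
  ultimately show ?thesis
    using that by blast
qed

subsection \<open>The Moore-Penrose inverse\<close>

text \<open>The Hermitian projections \<open>X A\<close> and \<open>Y A\<close> absorb each other,
  so taking adjoints of a product identifies them; likewise \<open>A X\<close> and
  \<open>A Y\<close>. Then \<open>X = X A X = Y A Y = Y\<close>.\<close>

lemma is_mp_inverse_unique:
  assumes "is_mp_inverse A X" "is_mp_inverse A Y"
  shows "X = Y"
proof -
  have X: "A ** X ** A = A" "X ** A ** X = X"
    "conj_transpose (A ** X) = A ** X" "conj_transpose (X ** A) = X ** A"
    and Y: "A ** Y ** A = A" "Y ** A ** Y = Y"
    "conj_transpose (A ** Y) = A ** Y" "conj_transpose (Y ** A) = Y ** A"
    using assms unfolding is_mp_inverse_def by auto
  have "X ** A = (X ** A) ** (Y ** A)"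
    using Y(1) by (metis matrix_mul_assoc)
  also have "\<dots> = conj_transpose ((Y ** A) ** (X ** A))"
    by (simp only: conj_transpose_mult[of "Y ** A"] X(4) Y(4))
  also have "\<dots> = Y ** A"
    using X(1) Y(4) by (metis matrix_mul_assoc)
  finally have l: "X ** A = Y ** A" .
  have "A ** X = (A ** Y) ** (A ** X)"
    using Y(1) by (metis matrix_mul_assoc)
  also have "\<dots> = conj_transpose ((A ** X) ** (A ** Y))"
    by (simp only: conj_transpose_mult[of "A ** X"] X(3) Y(3))
  also have "\<dots> = A ** Y"
    using X(1) Y(3) by (metis matrix_mul_assoc)
  finally have r: "A ** X = A ** Y" .
  show ?thesis
    using l r X(2) Y(2) by (metis matrix_mul_assoc)
qed

lemma conj_transpose_gram_cancel:
  assumes "conj_transpose A ** A ** V = conj_transpose A ** A ** W"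
  shows "A ** V = A ** W"
proof -
  have "conj_transpose A ** (A ** (V - W)) = 0"
    using assms by (simp add: matrix_diff_ldistrib matrix_mul_assoc)
  then have "conj_transpose (A ** (V - W)) ** (A ** (V - W)) = 0"
    by (simp add: conj_transpose_mult flip: matrix_mul_assoc)
  then have "A ** (V - W) = 0"
    by (rule conj_transpose_mult_self_eq_0)
  then show ?thesis
    by (simp add: matrix_diff_ldistrib)
qed

text \<open>The witness is \<open>Z A*\<close>, modelled on the left inverse
  \<open>(A* A)^-1 A*\<close> of an injective \<open>A\<close>; \<open>Z\<close> stands in for the
  inverse of \<open>B = A* A\<close>.\<close>

lemma is_mp_inverse_ex: "\<exists>X. is_mp_inverse A X"
proof -
  define B where "B = conj_transpose A ** A"
  have hB: "conj_transpose B = B"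
    by (simp add: B_def conj_transpose_mult)
  obtain k Z where BZ: "B ** Z = Z ** B" and k: "mat_power B (Suc k) ** Z = mat_power B k"
    by (rule mat_power_factorization)
  \<comment> \<open>Gram cancellation lowers the exponent step by step until only \<open>A\<close>
    is left in front of \<open>B Z\<close>.\<close>
  have "mat_power B j ** (B ** Z) = mat_power B j \<Longrightarrow> A ** (B ** Z) = A" for j
  proof (induction j)
    case 0
    then show ?case
      by simp
  next
    case (Suc j)
    have "B ** (mat_power B j ** (B ** Z)) = B ** mat_power B j"
      using Suc.prems by (simp add: matrix_mul_assoc)
    then have 1: "A ** (mat_power B j ** (B ** Z)) = A ** mat_power B j"
      unfolding B_def by (rule conj_transpose_gram_cancel)
    show ?case
    proof (cases j)
      case 0
      then show ?thesis
        using 1 by simp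
    next
      case (Suc i)
      \<comment> \<open>The factor \<open>A*\<close> restores a full \<open>B\<close> on the left.
        Since \<open>B\<close> is Hermitian, \<open>B B = B* B\<close>, and cancellation applies to
        \<open>B\<close> itself.\<close>
      have "conj_transpose A ** (A ** (mat_power B j ** (B ** Z)))
          = conj_transpose A ** (A ** mat_power B j)"
        using 1 by simp
      then have "B ** B ** (mat_power B i ** (B ** Z)) = B ** B ** mat_power B i"
        by (simp add: Suc B_def matrix_mul_assoc)
      then have "conj_transpose B ** B ** (mat_power B i ** (B ** Z))
          = conj_transpose B ** B ** mat_power B i"
        by (simp add: hB)
      then have "B ** (mat_power B i ** (B ** Z)) = B ** mat_power B i"
        by (rule conj_transpose_gram_cancel)
      then show ?thesis
        using Suc.IH by (simp add: \<open>j = Suc i\<close> matrix_mul_assoc)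
    qed
  qed
  then have Ae: "A ** (B ** Z) = A"
    using k by (metis mat_power_Suc_right matrix_mul_assoc)
  define e where "e = B ** Z"
  define X where "X = Z ** conj_transpose A"
  have eA: "conj_transpose e ** conj_transpose A = conj_transpose A"
    using Ae conj_transpose_mult e_def by metis
  \<comment> \<open>A matrix of the form \<open>e* e\<close> is Hermitian, hence so is
    \<open>e\<close>.\<close>
  have "conj_transpose e ** e = e"
    unfolding e_def B_def using eA by (metis e_def B_def matrix_mul_assoc)
  then have he: "conj_transpose e = e"
    by (metis conj_transpose_mult conj_transpose_conj_transpose)
  have XA: "X ** A = e"
    by (simp add: X_def e_def BZ) (simp add: B_def matrix_mul_assoc)
  have g: "conj_transpose A ** (A ** X) = conj_transpose A"
    using eA he by (simp add: X_def e_def B_def matrix_mul_assoc)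
  then have "conj_transpose (A ** X) ** (A ** X) = conj_transpose (A ** X)"
    by (metis conj_transpose_mult matrix_mul_assoc)
  then have hg: "conj_transpose (A ** X) = A ** X"
    by (metis conj_transpose_mult conj_transpose_conj_transpose)
  have "X ** A ** X = X"
    using g by (metis X_def matrix_mul_assoc)
  moreover have "A ** X ** A = A"
    using XA Ae e_def by (metis matrix_mul_assoc)
  ultimately show ?thesis
    using hg he XA unfolding is_mp_inverse_def by auto
qed

lemma is_mp_inverse_mp_inverse: "is_mp_inverse A (mp_inverse A)"
  unfolding mp_inverse_def 
  by (rule theI'[OF ex_ex1I[OF is_mp_inverse_ex is_mp_inverse_unique]])

subsection \<open>The Drazin inverse\<close>

text \<open>The idempotent \<open>X A\<close> equals \<open>X^(k+1) A^(k+1)\<close> for every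
  \<open>k\<close>, and for large \<open>k\<close> the factor \<open>A^(k+1)\<close> absorbs
  \<open>A Y\<close>.\<close>

lemma is_drazin_inverse_absorb:
  assumes "is_drazin_inverse A X" "is_drazin_inverse A Y"
  shows "A ** X = A ** X ** (A ** Y)"
proof -
  have AX: "A ** X = X ** A" and XAX: "X ** A ** X = X"
    using assms unfolding is_drazin_inverse_def by auto
  obtain k where k: "mat_power A (Suc k) ** Y = mat_power A k"
    using assms unfolding is_drazin_inverse_def by auto
  have "mat_power A (Suc k) ** (A ** Y) = A ** (mat_power A (Suc k) ** Y)"
    using mat_power_commute[of A A "Suc k"] by (metis matrix_mul_assoc)
  then have k': "mat_power A (Suc k) ** (A ** Y) = mat_power A (Suc k)"
    by (metis k mat_power.simps(2))
  have "(X ** A) ** (X ** A) = X ** A"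
    using XAX by (simp add: matrix_mul_assoc)
  then have "X ** A = mat_power (X ** A) (Suc k)"
    by (simp only: mat_power_idempotent)
  also have "\<dots> = mat_power X (Suc k) ** mat_power A (Suc k)"
    by (simp only: mat_power_mult_left AX)
  finally show ?thesis
    using k' AX by (metis matrix_mul_assoc)
qed

lemma is_drazin_inverse_unique:
  assumes "is_drazin_inverse A X" "is_drazin_inverse A Y"
  shows "X = Y"
proof -
  have X: "X ** A ** X = X" "A ** X = X ** A" and Y: "Y ** A ** Y = Y" "A ** Y = Y ** A"
    using assms unfolding is_drazin_inverse_def by auto
  obtain k where k: "mat_power A (Suc k) ** X = mat_power A k"
    using assms unfolding is_drazin_inverse_def by auto
  \<comment> \<open>This is the mirror image of the absorption lemma, with the exponent now taken
    from \<open>X\<close>.\<close>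
  have "A ** Y = A ** X ** (A ** Y)"
  proof -
    have "A ** X ** mat_power A (Suc k) = mat_power A (Suc k)"
      using k X(2) mat_power_commute[of A "A ** X"]
      by (metis mat_power.simps(2) mat_power_commute matrix_mul_assoc)
    moreover have "A ** Y = mat_power A (Suc k) ** mat_power Y (Suc k)"
      using mat_power_idempotent[of "A ** Y" k] Y
      by (metis mat_power_mult_left matrix_mul_assoc)
    ultimately show ?thesis
      by (metis matrix_mul_assoc)
  qed
  then have "A ** X = A ** Y"
    using is_drazin_inverse_absorb[OF assms] by simp
  then show ?thesis
    using X Y by (metis matrix_mul_assoc)
qed

lemma is_drazin_inverse_ex: "\<exists>X. is_drazin_inverse A X"
proof -
  obtain k Y where AY: "A ** Y = Y ** A" and k: "mat_power A (Suc k) ** Y = mat_power A k"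
    by (rule mat_power_factorization)
  have pow: "mat_power A k ** mat_power (A ** Y) j = mat_power A k" for j
  proof (induction j)
    case (Suc j)
    have "mat_power A k ** (A ** Y) = mat_power A k"
      using k by (metis mat_power_Suc_right matrix_mul_assoc)
    then show ?case
      using Suc by (simp add: matrix_mul_assoc)
  qed simp
  \<comment> \<open>The exponents are chosen so that \<open>A X = (A Y)^(k+1)\<close>, and
    \<open>A^k\<close> absorbs powers of \<open>A Y\<close>.\<close>
  define X where "X = mat_power A k ** mat_power Y (Suc k)"
  have YA: "mat_power Y (Suc k) ** A = A ** mat_power Y (Suc k)"
    using AY by (intro mat_power_commute) simp
  have comm: "A ** X = X ** A"
    using YA mat_power_commute[of A A k] unfolding X_def by (metis matrix_mul_assoc)
  have AX: "A ** X = mat_power (A ** Y) (Suc k)"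
    unfolding mat_power_mult_left[OF AY] X_def by (simp add: matrix_mul_assoc)
  have "mat_power A k ** (A ** X) = mat_power A k"
    unfolding AX by (rule pow)
  then have 1: "mat_power A (Suc k) ** X = mat_power A k"
    by (metis mat_power_Suc_right matrix_mul_assoc)
  have "A ** X ** mat_power A k = mat_power A k"
    using 1 comm by (metis mat_power_commute mat_power_Suc_right matrix_mul_assoc)
  then have "X ** A ** X = X"
    unfolding comm[symmetric] by (metis X_def matrix_mul_assoc)
  then show ?thesis
    using 1 comm unfolding is_drazin_inverse_def by blast
qed

lemma is_drazin_inverse_drazin_inverse: "is_drazin_inverse A (drazin_inverse A)"
  unfolding drazin_inverse_def
  by (rule theI'[OF ex_ex1I[OF is_drazin_inverse_ex is_drazin_inverse_unique]])

subsection \<open>The CMP-inverse\<close>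

theorem corollary5:
  fixes A :: "complex ^ 'n ^ 'n"
  shows "EP_matrix (cmp_inverse A) \<longleftrightarrow>
    mpd_inverse A ** mp_inverse (cmp_inverse A) =
    mp_inverse (cmp_inverse A) ** dmp_inverse A"
proof -
  define P where "P = mp_inverse A"
  define D where "D = drazin_inverse A"
  define C where "C = cmp_inverse A"
  define Q where "Q = mp_inverse C"
  define H where "H = P ** A"
  define K where "K = A ** P"
  define F where "F = C ** Q"
  define G where "G = Q ** C"
  note assoc = matrix_mul_assoc
  have P: "A ** P ** A = A" "P ** A ** P = P" "conj_transpose K = K" "conj_transpose H = H"
    using is_mp_inverse_mp_inverse[of A] by (auto simp: P_def H_def K_def is_mp_inverse_def)
  have Q: "C ** Q ** C = C" "Q ** C ** Q = Q" "conj_transpose F = F" "conj_transpose G = G"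
    using is_mp_inverse_mp_inverse[of C] by (auto simp: Q_def F_def G_def is_mp_inverse_def)
  have D: "D ** A ** D = D" "A ** D = D ** A"
    using is_drazin_inverse_drazin_inverse[of A] by (auto simp: D_def is_drazin_inverse_def)
  have C: "C = H ** D ** K"
    by (simp add: C_def H_def K_def P_def D_def cmp_inverse_def core_part_def assoc)
  have mpd: "mpd_inverse A = H ** D" and dmp: "dmp_inverse A = D ** K"
    by (simp_all add: mpd_inverse_def dmp_inverse_def H_def K_def P_def D_def assoc)
  have KD: "K ** D = D" and DH: "D ** H = D"
    using D P(1) unfolding K_def H_def by (metis assoc)+
  have HH: "H ** H = H" and KK: "K ** K = K"
    using P(1) unfolding H_def K_def by (metis assoc)+
  have HF: "H ** F = F" and GK: "G ** K = G"
    using HH KK unfolding F_def G_def C by (metis assoc)+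
  have FH: "F ** H = F"
    using HF P(4) Q(3) conj_transpose_mult by metis
  have KG: "K ** G = G"
    using GK P(3) Q(4) conj_transpose_mult by metis
  \<comment> \<open>These identities witness that \<open>C\<close> and \<open>H D\<close> share
    their range, and \<open>C\<close> and \<open>D K\<close> their row space.\<close>
  have CA: "C ** A ** D = H ** D" and AC: "D ** A ** C = D ** K"
    using P(1) D unfolding C K_def H_def by (metis assoc)+
  have "F ** (H ** D) = H ** D"
    using CA Q(1) unfolding F_def by (metis assoc)
  then have FD: "F ** D = H ** D"
    using FH by (metis assoc)
  have "(D ** K) ** G = D ** K"
    using AC Q(1) unfolding G_def by (metis assoc)
  then have DG: "D ** G = D ** K"
    using KG by (metis assoc)
  have QF: "Q ** F = Q" and GQ: "G ** Q = Q"
    using Q(2) by (simp_all add: F_def G_def assoc)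
  have "F = G \<longleftrightarrow> H ** D ** Q = Q ** (D ** K)"
  proof
    assume "F = G"
    \<comment> \<open>Insert \<open>Q = G Q\<close> and replace \<open>D G\<close> by
      \<open>D K\<close>; this gives \<open>C Q\<close>.\<close>
    then have "H ** D ** Q = F"
      using DG GQ unfolding F_def C by (metis assoc)
    moreover have "Q ** (D ** K) = G"
      using \<open>F = G\<close> FD QF unfolding G_def C by (metis assoc)
    ultimately show "H ** D ** Q = Q ** (D ** K)"
      using \<open>F = G\<close> by simp
  next
    assume eq: "H ** D ** Q = Q ** (D ** K)"
    have "Q ** (D ** K) ** F = Q ** (D ** K)"
      using eq QF by (metis assoc)
    \<comment> \<open>Multiplying by \<open>C\<close> on the left turns \<open>Q\<close> into
      \<open>F\<close>, after which \<open>F D = H D\<close> rebuilds \<open>C\<close>.\<close>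
    then have "F ** D ** K ** F = F ** D ** K"
      unfolding F_def by (metis assoc)
    then have CF: "C ** F = C"
      by (simp add: FD C)
    have "G ** (H ** D ** Q) = H ** D ** Q"
      using eq GQ by (metis assoc)
    then have "G ** H ** (D ** G) = H ** (D ** G)"
      unfolding G_def by (metis assoc)
    then have GC: "G ** C = C"
      by (simp add: DG C assoc)
    have "G = G ** F"
      using CF unfolding G_def by (metis assoc)
    also have "\<dots> = F"
      using GC unfolding F_def by (metis assoc)
    finally show "F = G"
      by simp
  qed
  then show ?thesis
    by (simp add: EP_matrix_def mpd dmp F_def G_def Q_def flip: C_def)
qed

end
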